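(* Let $k\ge 3$ be an integer and let $G$ be a graph with $c$ (connected) components, of order $n$, size $m$ and maximum degree $\Delta(G)\le k$. If no component of $G$ is $k$-regular, then $$\alpha'(G) \ge \left(\frac{1}{k(k+1)}\right)(n-c) + \left(\frac{1}{k+1}\right) m \quad\text{if } k \text{ is even},$$ and $$\alpha'(G) \ge \left(\frac{k-1}{k(k^2-3)}\right)(n-c) + \left(\frac{k^2-k-2}{k(k^2-3)}\right) m \quad\text{if } k \text{ is odd}.$$
   Context: Graphs are finite, simple and undirected (not necessarily connected). The order of a graph is its number of vertices and the size is its number of edges. The matching number $\alpha'(G)$ is the maximum number of edges in a matching of $G$. *)

theory Defs
  imports Complex_Main
begin

text \<open>
  A graph is given by its vertex set \<open>V\<close> and its edge set \<open>E\<close>, the edges being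
  two-element sets of vertices. The graph with no vertices is not excluded.
\<close>

definition simple_graph :: "'a set \<Rightarrow> 'a set set \<Rightarrow> bool" where
  "simple_graph V E \<longleftrightarrow> finite V \<and> E \<subseteq> {e. e \<subseteq> V \<and> card e = 2}"

definition graph_degree :: "'a set set \<Rightarrow> 'a \<Rightarrow> nat" where
  "graph_degree E v = card {e \<in> E. v \<in> e}"

text \<open>The \<open>insert 0\<close> only fixes the value for the graph with no vertices.\<close>

definition max_degree :: "'a set \<Rightarrow> 'a set set \<Rightarrow> nat" where
  "max_degree V E = Max (insert 0 (graph_degree E ` V))"

definition graph_reachable :: "'a set \<Rightarrow> 'a set set \<Rightarrow> ('a \<times> 'a) set" where
  "graph_reachable V E = {(u, v). u \<in> V \<and> v \<in> V \<and> (u, v) \<in> {(x, y). {x, y} \<in> E}\<^sup>*}"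

text \<open>
  A component is represented by its vertex set \<open>C\<close>; as a graph it is the
  subgraph \<open>(C, induced_edges E C)\<close> induced by \<open>C\<close>.
\<close>

definition graph_components :: "'a set \<Rightarrow> 'a set set \<Rightarrow> 'a set set" where
  "graph_components V E = V // graph_reachable V E"

definition induced_edges :: "'a set set \<Rightarrow> 'a set \<Rightarrow> 'a set set" where
  "induced_edges E C = {e \<in> E. e \<subseteq> C}"

definition regular_graph :: "nat \<Rightarrow> 'a set \<Rightarrow> 'a set set \<Rightarrow> bool" where
  "regular_graph k V E \<longleftrightarrow> (\<forall>v\<in>V. graph_degree E v = k)"

definition graph_matching :: "'a set set \<Rightarrow> 'a set set \<Rightarrow> bool" where
  "graph_matching E M \<longleftrightarrow> M \<subseteq> E \<and> pairwise disjnt M"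

definition matching_number :: "'a set set \<Rightarrow> nat" where
  "matching_number E = Max (card ` {M. graph_matching E M})"

end

theory Submission
  imports Defs
begin

text \<open>
  Write $f(G) = a(n-c) + bm$ for the claimed bound; in both cases $(a+b)k = 1$.
  If some vertex $v$ is covered by every maximum matching, then deleting $v$ lowers the matching
  number by one and lowers $f$ by at most $(a+b)\deg v \le 1$, because $n - c$ drops by at
  most $\deg v$; moreover a component of $G - v$ either is a component of $G$ or contains
  a neighbour of $v$, so it still has a vertex of degree less than $k$.
  If there is no such vertex, Gallai's lemma says that a maximum matching misses at most one vertex
  of every component, so it has $\lfloor |C|/2 \rfloor$ edges in each component $C$, and it
  remains to count edges: $2m(C) < k|C|$ and $2m(C) \le |C|(|C|-1)$.
\<close>

subsection \<open>Graphs and components\<close>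

lemma simple_graph_finite:
  assumes "simple_graph V E"
  shows "finite V" "finite E"
proof -
  show "finite V" using assms by (simp add: simple_graph_def)
  moreover have "E \<subseteq> Pow V" using assms by (auto simp: simple_graph_def)
  ultimately show "finite E" by (meson finite_Pow_iff finite_subset)
qed

lemma simple_graph_edge:
  assumes "simple_graph V E" "e \<in> E"
  shows "e \<subseteq> V" "card e = 2"
  using assms by (auto simp: simple_graph_def)

lemma simple_graph_edge_ends:
  assumes "simple_graph V E" "e \<in> E" "x \<in> e"
  obtains y where "e = {x, y}" "x \<noteq> y" "x \<in> V" "y \<in> V"
proof -
  have "card e = 2" "e \<subseteq> V" using simple_graph_edge[OF assms(1,2)] by auto
  then obtain p q where pq: "e = {p, q}" "p \<noteq> q" by (meson card_2_iff)
  show ?thesis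
  proof (cases "x = p")
    case True
    then show ?thesis using pq \<open>e \<subseteq> V\<close> that[of q] by auto
  next
    case False
    then have "x = q" using pq assms(3) by auto
    then show ?thesis using pq \<open>e \<subseteq> V\<close> that[of p] by auto
  qed
qed

lemma equiv_graph_reachable: "equiv V (graph_reachable V E)"
proof (rule equivI)
  have "sym ({(x, y). {x, y} \<in> E}\<^sup>*)"
    by (rule sym_rtrancl) (auto simp: sym_def insert_commute)
  then show "sym (graph_reachable V E)"
    unfolding sym_def graph_reachable_def by blast
  show "trans (graph_reachable V E)"
    unfolding trans_def graph_reachable_def by (blast intro: rtrancl_trans)
qed (auto simp: graph_reachable_def refl_on_def)

lemma component_subset: "C \<in> graph_components V E \<Longrightarrow> C \<subseteq> V"
  unfolding graph_components_def using equiv_graph_reachable in_quotient_imp_subset by metis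

lemma component_nonempty: "C \<in> graph_components V E \<Longrightarrow> C \<noteq> {}"
  unfolding graph_components_def using equiv_graph_reachable in_quotient_imp_non_empty by metis

lemma Union_components: "\<Union> (graph_components V E) = V"
  unfolding graph_components_def by (rule Union_quotient[OF equiv_graph_reachable])

lemma components_disjoint:
  assumes "C \<in> graph_components V E" "D \<in> graph_components V E" "C \<noteq> D"
  shows "C \<inter> D = {}"
  using assms quotient_disj[OF equiv_graph_reachable] unfolding graph_components_def by metis

lemma finite_components: "finite V \<Longrightarrow> finite (graph_components V E)"
  using finite_UnionD[of "graph_components V E"] Union_components[of V E] by simp

lemma component_eq_class:
  assumes "C \<in> graph_components V E" "u \<in> C"
  shows "C = graph_reachable V E `` {u}"
  using assms equiv_graph_reachable[of V E] unfolding graph_components_def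
  by (metis Image_singleton_iff equiv_class_eq_iff quotientE)

lemma class_component: "u \<in> V \<Longrightarrow> graph_reachable V E `` {u} \<in> graph_components V E"
  unfolding graph_components_def by (rule quotientI)

lemma component_reachable:
  assumes "C \<in> graph_components V E" "u \<in> C" "w \<in> C"
  shows "(u, w) \<in> {(x, y). {x, y} \<in> E}\<^sup>*"
  using component_eq_class[OF assms(1,2)] assms(3) by (auto simp: graph_reachable_def)

lemma component_closed:
  assumes "simple_graph V E" "C \<in> graph_components V E" "u \<in> C" "{u, w} \<in> E"
  shows "w \<in> C"
proof -
  have "u \<in> V" "w \<in> V" using simple_graph_edge[OF assms(1,4)] by auto
  then have "(u, w) \<in> graph_reachable V E" using assms(4) by (auto simp: graph_reachable_def)
  then show ?thesis using component_eq_class[OF assms(2,3)] by auto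
qed

lemma component_edge_subset:
  assumes "simple_graph V E" "C \<in> graph_components V E" "e \<in> E" "u \<in> C" "u \<in> e"
  shows "e \<subseteq> C"
proof -
  obtain w where "e = {u, w}" using simple_graph_edge_ends[OF assms(1,3,5)] by metis
  then show ?thesis using component_closed[OF assms(1,2,4)] assms by auto
qed

text \<open>\<open>closed\<close> keeps every path that starts at \<open>u\<close> inside
  \<open>C\<close>, and \<open>reach\<close> says that such paths exhaust \<open>C\<close>. So
  \<open>C\<close> is the equivalence class of \<open>u\<close>.\<close>

lemma componentI:
  assumes "u \<in> C" "C \<subseteq> V"
    and reach: "\<And>w. w \<in> C \<Longrightarrow> (u, w) \<in> {(x, y). {x, y} \<in> E}\<^sup>*"
    and closed: "\<And>x y. x \<in> C \<Longrightarrow> {x, y} \<in> E \<Longrightarrow> y \<in> C"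
  shows "C \<in> graph_components V E"
proof -
  have "w \<in> C" if "(u, w) \<in> {(x, y). {x, y} \<in> E}\<^sup>*" for w
    using that by (induction rule: rtrancl_induct) (use assms(1) closed in auto)
  then have "C = graph_reachable V E `` {u}"
    using assms(1,2) reach by (auto simp: graph_reachable_def)
  then show ?thesis using assms(1,2) class_component[of u V E] by auto
qed

lemma card_component_sum:
  assumes "finite V"
  shows "card V = (\<Sum>C\<in>graph_components V E. card C)"
proof -
  have "card (\<Union> (graph_components V E)) = (\<Sum>C\<in>graph_components V E. card C)"
  proof (rule card_Union_disjoint)
    show "pairwise disjnt (graph_components V E)"
      using components_disjoint by (metis disjnt_def pairwiseI)
    show "finite C" if "C \<in> graph_components V E" for C
      using component_subset[OF that] assms finite_subset by blast
  qed
  then show ?thesis by (simp add: Union_components)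
qed

text \<open>Each edge lies in exactly one component. The components are those of \<open>E\<close>
  while the counted edges come from a subset \<open>F\<close>, so that the formula applies both to
  \<open>E\<close> itself and to a maximum matching.\<close>

lemma card_induced_edges_sum:
  assumes "simple_graph V E" "F \<subseteq> E"
  shows "card F = (\<Sum>C\<in>graph_components V E. card (induced_edges F C))"
proof -
  \<comment> \<open>An empty edge would be induced by every component, and the union below would not
    be disjoint.\<close>
  have ne: "e \<noteq> {}" if "e \<in> F" for e
    using simple_graph_edge(2)[OF assms(1), of e] that assms(2) by auto
  have "F = (\<Union>C\<in>graph_components V E. induced_edges F C)"
  proof
    show "F \<subseteq> (\<Union>C\<in>graph_components V E. induced_edges F C)"
    proof
      fix e assume e: "e \<in> F"
      then obtain u where u: "u \<in> e" "u \<in> V"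
        using ne[OF e] simple_graph_edge(1)[OF assms(1), of e] assms(2) by blast
      then obtain C where C: "C \<in> graph_components V E" "u \<in> C" using Union_components[of V E] by blast
      then have "e \<subseteq> C" using component_edge_subset[OF assms(1)] e u assms(2) by blast
      then show "e \<in> (\<Union>C\<in>graph_components V E. induced_edges F C)"
        using C e by (auto simp: induced_edges_def)
    qed
  qed (auto simp: induced_edges_def)
  then have "card F = card (\<Union>C\<in>graph_components V E. induced_edges F C)" by simp
  also have "\<dots> = (\<Sum>C\<in>graph_components V E. card (induced_edges F C))"
  proof (rule card_UN_disjoint)
    show "finite (graph_components V E)"
      using finite_components simple_graph_finite[OF assms(1)] by blast
    show "\<forall>C\<in>graph_components V E. finite (induced_edges F C)"
      using simple_graph_finite[OF assms(1)] assms(2)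
      by (auto simp: induced_edges_def intro: finite_subset)
    show "\<forall>C\<in>graph_components V E. \<forall>D\<in>graph_components V E.
        C \<noteq> D \<longrightarrow> induced_edges F C \<inter> induced_edges F D = {}"
    proof (intro ballI impI)
      fix C D assume "C \<in> graph_components V E" "D \<in> graph_components V E" "C \<noteq> D"
      then have "C \<inter> D = {}" by (rule components_disjoint)
      then show "induced_edges F C \<inter> induced_edges F D = {}"
        using ne unfolding induced_edges_def by blast
    qed
  qed
  finally show ?thesis .
qed

subsection \<open>Degrees and edge counts\<close>

lemma simple_graph_induced:
  assumes "simple_graph V E" "C \<subseteq> V"
  shows "simple_graph C (induced_edges E C)"
  using assms finite_subset by (auto simp: simple_graph_def induced_edges_def)

lemma graph_degree_mono: "finite E \<Longrightarrow> F \<subseteq> E \<Longrightarrow> graph_degree F v \<le> graph_degree E v"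
  unfolding graph_degree_def by (rule card_mono) auto

lemma graph_degree_strict_mono:
  assumes "finite E" "F \<subseteq> E" "e \<in> E" "e \<notin> F" "v \<in> e"
  shows "graph_degree F v < graph_degree E v"
  unfolding graph_degree_def by (rule psubset_card_mono) (use assms in auto)

lemma graph_degree_component:
  assumes "simple_graph V E" "C \<in> graph_components V E" "u \<in> C"
  shows "graph_degree (induced_edges E C) u = graph_degree E u"
proof -
  have "{e \<in> induced_edges E C. u \<in> e} = {e \<in> E. u \<in> e}"
    using component_edge_subset[OF assms(1,2) _ assms(3)] by (auto simp: induced_edges_def)
  then show ?thesis by (simp add: graph_degree_def)
qed

lemma handshake:
  assumes "simple_graph V E"
  shows "(\<Sum>v\<in>V. graph_degree E v) = 2 * card E"
proof -
  have "(\<Sum>v\<in>V. card {e \<in> E. v \<in> e}) = 2 * card E"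
  proof (rule sum_multicount)
    show "finite V" "finite E" using simple_graph_finite[OF assms] by auto
    show "\<forall>e\<in>E. card {v \<in> V. v \<in> e} = 2"
    proof
      fix e assume that: "e \<in> E"
      have "{v \<in> V. v \<in> e} = e" using simple_graph_edge(1)[OF assms that] by blast
      then show "card {v \<in> V. v \<in> e} = 2" using simple_graph_edge(2)[OF assms that] by simp
    qed
  qed
  then show ?thesis by (simp add: graph_degree_def)
qed

lemma card_edges_le:
  assumes "simple_graph V E"
  shows "2 * card E \<le> card V * (card V - 1)"
proof -
  have fin: "finite V" using simple_graph_finite[OF assms] by simp
  have "E \<subseteq> {e. e \<subseteq> V \<and> card e = 2}" using assms by (simp add: simple_graph_def)
  then have "card E \<le> card {e. e \<subseteq> V \<and> card e = 2}"
    by (rule card_mono[rotated]) (use fin in auto)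
  also have "\<dots> = card V choose 2" using n_subsets[OF fin] by simp
  finally show ?thesis by (simp add: choose_two)
qed

text \<open>In the handshake sum all terms are at most \<open>k\<close> and the one at
  \<open>u\<close> is smaller.\<close>

lemma card_edges_less:
  assumes "simple_graph V E" "\<And>v. v \<in> V \<Longrightarrow> graph_degree E v \<le> k"
    and "u \<in> V" "graph_degree E u < k"
  shows "2 * card E < k * card V"
proof -
  have "2 * card E = (\<Sum>v\<in>V. graph_degree E v)" using handshake[OF assms(1)] by simp
  also have "\<dots> < (\<Sum>v\<in>V. k)"
    using simple_graph_finite(1)[OF assms(1)] assms(2-4) by (intro sum_strict_mono_ex1) auto
  finally show ?thesis by (simp add: mult.commute)
qed

subsection \<open>Deleting a vertex\<close>

text \<open>The only edges that deletion removes are those at \<open>v\<close>. A component of the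
  smaller graph that contains no neighbour of \<open>v\<close> is therefore closed under the edges
  of the whole graph as well.\<close>

lemma component_delete_vertex:
  assumes "simple_graph V E"
    and C: "C \<in> graph_components (V - {v}) (induced_edges E (V - {v}))"
    and nb: "\<And>w. w \<in> C \<Longrightarrow> {v, w} \<notin> E"
  shows "C \<in> graph_components V E"
proof -
  let ?V = "V - {v}" and ?E = "induced_edges E (V - {v})"
  have sub: "C \<subseteq> ?V" using component_subset[OF C] .
  obtain u where u: "u \<in> C" using component_nonempty[OF C] by blast
  have mono: "{(x, y). {x, y} \<in> ?E}\<^sup>* \<subseteq> {(x, y). {x, y} \<in> E}\<^sup>*"
    by (rule rtrancl_mono) (auto simp: induced_edges_def)
  show ?thesis
  proof (rule componentI[OF u])
    show "C \<subseteq> V" using sub by blast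
    show "(u, w) \<in> {(x, y). {x, y} \<in> E}\<^sup>*" if "w \<in> C" for w
      using component_reachable[OF C u that] mono by blast
    show "y \<in> C" if "x \<in> C" "{x, y} \<in> E" for x y
    proof -
      have "y \<noteq> v" using nb[OF that(1)] that(2) by (auto simp: insert_commute)
      then have "{x, y} \<in> ?E"
        using that sub simple_graph_edge(1)[OF assms(1) that(2)] by (auto simp: induced_edges_def)
      moreover have "simple_graph ?V ?E" by (rule simple_graph_induced[OF assms(1)]) auto
      ultimately show ?thesis using component_closed[OF _ C that(1)] by blast
    qed
  qed
qed

text \<open>The component \<open>D\<close> of \<open>v\<close> disappears. Every component of the
  smaller graph is either an old one other than \<open>D\<close> or the class of a neighbour of
  \<open>v\<close>, and there are at most \<open>graph_degree E v\<close> classes of the second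
  kind.\<close>

lemma card_components_delete_vertex:
  assumes G: "simple_graph V E" and v: "v \<in> V"
  shows "card (graph_components (V - {v}) (induced_edges E (V - {v}))) + 1
    \<le> card (graph_components V E) + graph_degree E v"
proof -
  let ?V = "V - {v}" and ?E = "induced_edges E (V - {v})"
  let ?K = "graph_components V E" and ?K' = "graph_components ?V ?E"
  let ?N = "{w. {v, w} \<in> E}"
  have fin: "finite V" "finite E" using simple_graph_finite[OF G] by auto
  have finK: "finite ?K" using finite_components fin by blast
  obtain D where D: "D \<in> ?K" "v \<in> D" using v Union_components[of V E] by blast
  have "?N \<subseteq> V" using simple_graph_edge(1)[OF G] by blast
  then have finN: "finite ?N" using fin finite_subset by blast
  have N: "card ?N \<le> graph_degree E v"
    unfolding graph_degree_def
  proof (rule card_inj_on_le)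
    show "inj_on (\<lambda>w. {v, w}) ?N" by (auto simp: inj_on_def doubleton_eq_iff)
  qed (use fin in auto)
  have "?K' \<subseteq> (?K - {D}) \<union> (\<lambda>w. graph_reachable ?V ?E `` {w}) ` ?N"
  proof
    fix C assume C: "C \<in> ?K'"
    show "C \<in> (?K - {D}) \<union> (\<lambda>w. graph_reachable ?V ?E `` {w}) ` ?N"
    proof (cases "\<exists>w\<in>C. {v, w} \<in> E")
      case True
      then show ?thesis using component_eq_class[OF C] by blast
    next
      case False
      then have "C \<in> ?K" using component_delete_vertex[OF G C] by blast
      \<comment> \<open>\<open>C\<close> differs from \<open>D\<close> because it does not contain
        \<open>v\<close>.\<close>
      then show ?thesis using component_subset[OF C] D(2) by blast
    qed
  qed
  then have "card ?K' \<le> card ((?K - {D}) \<union> (\<lambda>w. graph_reachable ?V ?E `` {w}) ` ?N)"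
    using finK finN by (intro card_mono) auto
  also have "\<dots> \<le> card (?K - {D}) + card ((\<lambda>w. graph_reachable ?V ?E `` {w}) ` ?N)"
    by (rule card_Un_le)
  also have "\<dots> \<le> card (?K - {D}) + card ?N" using card_image_le[OF finN] by simp
  finally show ?thesis using N card_Suc_Diff1[OF finK D(1)] by linarith
qed

lemma card_edges_delete_vertex:
  assumes "simple_graph V E"
  shows "card E = card (induced_edges E (V - {v})) + graph_degree E v"
proof -
  have "E = induced_edges E (V - {v}) \<union> {e \<in> E. v \<in> e}"
    using simple_graph_edge(1)[OF assms] by (auto simp: induced_edges_def)
  moreover have "card (induced_edges E (V - {v}) \<union> {e \<in> E. v \<in> e}) =
      card (induced_edges E (V - {v})) + card {e \<in> E. v \<in> e}"
    using simple_graph_finite(2)[OF assms]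
    by (intro card_Un_disjoint) (auto simp: induced_edges_def)
  ultimately show ?thesis by (simp add: graph_degree_def)
qed

subsection \<open>Maximum matchings and Gallai's lemma\<close>

definition maximum_matching :: "'a set set \<Rightarrow> 'a set set \<Rightarrow> bool" where
  "maximum_matching E M \<longleftrightarrow> graph_matching E M \<and> card M = matching_number E"

lemma finite_matchings: "finite E \<Longrightarrow> finite {M. graph_matching E M}"
  by (rule finite_subset[of _ "Pow E"]) (auto simp: graph_matching_def)

lemma card_matching_le:
  assumes "finite E" "graph_matching E M"
  shows "card M \<le> matching_number E"
  unfolding matching_number_def using finite_matchings[OF assms(1)] assms(2)
  by (intro Max_ge) auto

lemma maximum_matching_exists:
  assumes "finite E"
  obtains M where "maximum_matching E M"
proof -
  have "{} \<in> {M. graph_matching E M}" by (simp add: graph_matching_def)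
  then have "matching_number E \<in> card ` {M. graph_matching E M}"
    unfolding matching_number_def using finite_matchings[OF assms]
    by (intro Max_in) auto
  then show ?thesis using that by (auto simp: maximum_matching_def)
qed

lemma card_Union_matching:
  assumes "simple_graph V E" "graph_matching E M"
  shows "card (\<Union>M) = 2 * card M"
proof -
  have two: "\<And>e. e \<in> M \<Longrightarrow> card e = 2"
    using assms simple_graph_edge(2) by (metis graph_matching_def subsetD)
  have "card (\<Union>M) = sum card M"
    using assms(2) two
    by (intro card_Union_disjoint) (auto simp: graph_matching_def intro: card_ge_0_finite)
  then show ?thesis using two by simp
qed

lemma graph_matching_insert:
  assumes "graph_matching E M" "e \<in> E" "e \<inter> \<Union>M = {}"
  shows "graph_matching E (insert e M)"
  using assms unfolding graph_matching_def pairwise_insert disjnt_def by blast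

lemma maximum_matching_meets_edge:
  assumes "simple_graph V E" "maximum_matching E M" "e \<in> E"
  shows "e \<inter> \<Union>M \<noteq> {}"
proof
  assume *: "e \<inter> \<Union>M = {}"
  have M: "graph_matching E M" using assms(2) by (simp add: maximum_matching_def)
  have fin: "finite E" using simple_graph_finite[OF assms(1)] by simp
  have "e \<noteq> {}" using simple_graph_edge(2)[OF assms(1,3)] by auto
  then have "e \<notin> M" using * by blast
  moreover have "finite M" using M fin finite_subset by (auto simp: graph_matching_def)
  ultimately have "card (insert e M) = matching_number E + 1"
    using assms(2) by (simp add: maximum_matching_def)
  then show False
    using card_matching_le[OF fin graph_matching_insert[OF M assms(3) *]] by simp
qed

text \<open>A maximum matching of the smaller graph is a matching of the whole graph that misses
  \<open>v\<close>, so by \<open>cov\<close> it is not maximum there.\<close>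

lemma matching_number_delete_vertex:
  assumes "simple_graph V E" and cov: "\<And>M. maximum_matching E M \<Longrightarrow> v \<in> \<Union>M"
  shows "matching_number (induced_edges E (V - {v})) + 1 \<le> matching_number E"
proof -
  let ?E = "induced_edges E (V - {v})"
  have fin: "finite E" using simple_graph_finite[OF assms(1)] by simp
  have "finite ?E" using fin by (simp add: induced_edges_def)
  then obtain M where M: "maximum_matching ?E M" using maximum_matching_exists by blast
  then have M': "graph_matching E M" "v \<notin> \<Union>M"
    by (auto simp: maximum_matching_def graph_matching_def induced_edges_def)
  then have "card M \<noteq> matching_number E" using cov[of M] by (auto simp: maximum_matching_def)
  moreover have "card M \<le> matching_number E" using card_matching_le[OF fin M'(1)] .
  ultimately show ?thesis using M by (simp add: maximum_matching_def)
qed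

text \<open>Let \<open>e = {x, y}\<close> be the edge of \<open>M\<close> at \<open>x\<close>. As
  \<open>N\<close> is maximum and misses \<open>x\<close>, it covers \<open>y\<close> by an edge
  \<open>g\<close>, and \<open>g\<close> is not in \<open>M\<close> because \<open>M\<close> already
  has \<open>e\<close> at \<open>y\<close>. Replacing \<open>g\<close> by \<open>e\<close> in
  \<open>N\<close> keeps the size and gains one common edge with \<open>M\<close>. The only newly
  covered vertex is \<open>x\<close>, so \<open>t\<close> stays missed.\<close>

lemma maximum_matching_exchange:
  assumes G: "simple_graph V E"
    and M: "graph_matching E M" and N: "maximum_matching E N"
    and x: "x \<in> \<Union>M" "x \<notin> \<Union>N" and t: "t \<notin> \<Union>N" "t \<noteq> x"
  obtains N' where "maximum_matching E N'" "t \<notin> \<Union>N'" "card (M \<inter> N') = card (M \<inter> N) + 1"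
proof -
  have fin: "finite E" using simple_graph_finite[OF G] by simp
  have gN: "graph_matching E N" using N by (simp add: maximum_matching_def)
  have finM: "finite M" and finN: "finite N"
    using M gN fin finite_subset by (auto simp: graph_matching_def)
  obtain e where e: "e \<in> M" "x \<in> e" using x by blast
  then have eE: "e \<in> E" using M by (auto simp: graph_matching_def)
  obtain y where y: "e = {x, y}" using simple_graph_edge_ends[OF G eE e(2)] by metis
  have "y \<in> \<Union>N" using maximum_matching_meets_edge[OF G N eE] x(2) y by blast
  then obtain g where g: "g \<in> N" "y \<in> g" by blast
  have "e \<noteq> g" using x(2) e(2) g(1) by blast
  moreover have "y \<in> e \<inter> g" using g(2) y by simp
  ultimately have gM: "g \<notin> M"
    using M e(1) unfolding graph_matching_def pairwise_def disjnt_def by blast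
  have eN: "e \<notin> N" using e x(2) by blast
  let ?N = "insert e (N - {g})"
  have disj: "y \<notin> h" if "h \<in> N - {g}" for h
    using that g gN by (auto simp: graph_matching_def pairwise_def disjnt_def)
  have "graph_matching E ?N"
  proof (rule graph_matching_insert[OF _ eE])
    show "graph_matching E (N - {g})"
      using gN by (auto simp: graph_matching_def pairwise_def)
    show "e \<inter> \<Union>(N - {g}) = {}" using disj x(2) y by blast
  qed
  moreover have "card ?N = card N" using eN finN g(1) card_Suc_Diff1[OF finN g(1)] by simp
  ultimately have "maximum_matching E ?N" using N by (simp add: maximum_matching_def)
  moreover have "t \<notin> \<Union>?N" using t y \<open>y \<in> \<Union>N\<close> by blast
  moreover have "card (M \<inter> ?N) = card (M \<inter> N) + 1"
  proof -
    have "M \<inter> ?N = insert e (M \<inter> N)" using e(1) gM by blast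
    then show ?thesis using eN finN by simp
  qed
  ultimately show ?thesis by (rule that)
qed

text \<open>
  Given this transitivity, Gallai's lemma follows along paths, because no maximum matching misses
  both ends of an edge.
\<close>

lemma not_both_missed_trans:
  assumes G: "simple_graph V E"
    and ut: "\<And>M. maximum_matching E M \<Longrightarrow> u \<noteq> t \<Longrightarrow> u \<in> \<Union>M \<or> t \<in> \<Union>M"
    and tv: "\<And>M. maximum_matching E M \<Longrightarrow> t \<noteq> v \<Longrightarrow> t \<in> \<Union>M \<or> v \<in> \<Union>M"
    and missed: "maximum_matching E N\<^sub>0" "t \<notin> \<Union>N\<^sub>0"
    and M: "maximum_matching E M" and uv: "u \<noteq> v"
  shows "u \<in> \<Union>M \<or> v \<in> \<Union>M"
proof (rule ccontr)
  assume "\<not> ?thesis"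
  then have miss: "u \<notin> \<Union>M" "v \<notin> \<Union>M" by auto
  have fin: "finite E" and finV: "finite V" using simple_graph_finite[OF G] by auto
  have gM: "graph_matching E M" using M by (simp add: maximum_matching_def)
  have finM: "finite M" using gM fin finite_subset by (auto simp: graph_matching_def)
  \<comment> \<open>If \<open>M\<close> missed \<open>t\<close> too, then \<open>ut\<close> and
    \<open>tv\<close> would force \<open>u = t = v\<close>.\<close>
  have tM: "t \<in> \<Union>M" using miss ut[OF M] tv[OF M] uv by blast
  define P where "P = (\<lambda>N. maximum_matching E N \<and> t \<notin> \<Union>N)"
  have bound: "\<forall>N. P N \<longrightarrow> card (M \<inter> N) \<le> card M" using finM by (auto intro: card_mono)
  \<comment> \<open>Among the maximum matchings that miss \<open>t\<close>, take \<open>N\<close>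
    with the largest overlap with \<open>M\<close>; an exchange will produce a larger
    overlap.\<close>
  have "P N\<^sub>0" using missed by (simp add: P_def)
  then obtain N where N: "P N" and Nmax: "\<And>N'. P N' \<Longrightarrow> card (M \<inter> N') \<le> card (M \<inter> N)"
    using ex_has_greatest_nat[of P N\<^sub>0 "\<lambda>N. card (M \<inter> N)" "card M + 1"] bound
    by (metis less_Suc_eq_le Suc_eq_plus1)
  have mN: "maximum_matching E N" "t \<notin> \<Union>N" using N by (auto simp: P_def)
  have gN: "graph_matching E N" using mN by (simp add: maximum_matching_def)
  \<comment> \<open>\<open>t\<close> is covered by \<open>M\<close>, hence distinct from
    \<open>u\<close> and \<open>v\<close>; since \<open>N\<close> misses \<open>t\<close>, it must
    cover both.\<close>
  have cov: "u \<in> \<Union>N" "v \<in> \<Union>N" using ut[OF mN(1)] tv[OF mN(1)] mN(2) tM miss by metis+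
  have sub: "\<Union>M \<subseteq> V" "\<Union>N \<subseteq> V"
    using gM gN simple_graph_edge(1)[OF G] by (auto simp: graph_matching_def)
  have finU: "finite (\<Union>M)" "finite (\<Union>N)" using finite_subset[OF _ finV] sub by auto
  have "card (\<Union>M) = card (\<Union>N)"
    using card_Union_matching[OF G gM] card_Union_matching[OF G gN] M mN(1)
    by (simp add: maximum_matching_def)
  \<comment> \<open>Both matchings cover equally many vertices. As \<open>u\<close> and
    \<open>v\<close> are covered by \<open>N\<close> only, at least two vertices are covered by
    \<open>M\<close> only, and one of them is not \<open>t\<close>.\<close>
  then have eq: "card (\<Union>M - \<Union>N) = card (\<Union>N - \<Union>M)"
    using finU by (simp add: card_le_sym_Diff le_antisym)
  have "card {u, v} \<le> card (\<Union>N - \<Union>M)" using cov miss finU by (intro card_mono) auto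
  then have "card (\<Union>M - \<Union>N) \<ge> 2" using eq uv by simp
  then have "\<not> \<Union>M - \<Union>N \<subseteq> {t}" using card_mono[of "{t}" "\<Union>M - \<Union>N"] by auto
  then obtain x where x: "x \<in> \<Union>M" "x \<notin> \<Union>N" "t \<noteq> x" by blast
  obtain N' where "maximum_matching E N'" "t \<notin> \<Union>N'" "card (M \<inter> N') = card (M \<inter> N) + 1"
    using maximum_matching_exchange[OF G gM mN(1) x(1,2) mN(2) x(3)] .
  then show False using Nmax[of N'] by (simp add: P_def)
qed

text \<open>\<open>all_missed\<close> supplies, for each intermediate vertex of a path from
  \<open>u\<close> to \<open>v\<close>, the maximum matching missing it that transitivity requires
  of its middle vertex.\<close>

lemma gallai:
  assumes G: "simple_graph V E"
    and all_missed: "\<And>v. v \<in> V \<Longrightarrow> \<exists>M. maximum_matching E M \<and> v \<notin> \<Union>M"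
    and C: "C \<in> graph_components V E" "u \<in> C" "v \<in> C" and uv: "u \<noteq> v"
    and M: "maximum_matching E M"
  shows "u \<in> \<Union>M \<or> v \<in> \<Union>M"
proof -
  have "(u, v) \<in> {(x, y). {x, y} \<in> E}\<^sup>*" using component_reachable[OF C] .
  \<comment> \<open>The claim is generalised over \<open>M\<close> because the transitivity step
    applies it to other maximum matchings as well.\<close>
  then have "\<forall>M. maximum_matching E M \<longrightarrow> u \<noteq> v \<longrightarrow> u \<in> \<Union>M \<or> v \<in> \<Union>M"
  proof (induction rule: rtrancl_induct)
    case (step t w)
    then have tw: "{t, w} \<in> E" by simp
    then have "t \<in> V" using simple_graph_edge(1)[OF G] by blast
    then obtain N where N: "maximum_matching E N" "t \<notin> \<Union>N" using all_missed by blast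
    have "\<And>M. maximum_matching E M \<Longrightarrow> t \<in> \<Union>M \<or> w \<in> \<Union>M"
      using maximum_matching_meets_edge[OF G _ tw] by blast
    then show ?case using not_both_missed_trans[OF G _ _ N, of u w] step.IH by blast
  qed simp
  then show ?thesis using M uv by blast
qed

text \<open>By Gallai's lemma \<open>M\<close> misses at most one vertex of \<open>C\<close>, and an
  edge of \<open>M\<close> that covers a vertex of \<open>C\<close> lies inside
  \<open>C\<close>.\<close>

lemma card_component_le_matching:
  assumes G: "simple_graph V E"
    and all_missed: "\<And>v. v \<in> V \<Longrightarrow> \<exists>M. maximum_matching E M \<and> v \<notin> \<Union>M"
    and C: "C \<in> graph_components V E"
    and M: "maximum_matching E M"
  shows "card C \<le> 2 * card (induced_edges M C) + 1"
proof -
  have gM: "graph_matching E M" using M by (simp add: maximum_matching_def)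
  then have gMC: "graph_matching E (induced_edges M C)"
    by (auto simp: graph_matching_def induced_edges_def pairwise_def)
  let ?U = "\<Union>(induced_edges M C)"
  have finC: "finite C"
    using component_subset[OF C] simple_graph_finite(1)[OF G] finite_subset by blast
  have U: "x \<in> ?U" if "x \<in> C" "x \<in> \<Union>M" for x
    using that component_edge_subset[OF G C] gM by (auto simp: graph_matching_def induced_edges_def)
  have finU: "finite ?U" by (rule finite_subset[OF _ finC]) (auto simp: induced_edges_def)
  have "u = w" if "u \<in> C - ?U" "w \<in> C - ?U" for u w
    using gallai[OF G all_missed C _ _ _ M, of u w] U that by blast
  then have "card (C - ?U) \<le> 1" using finC by (simp add: card_le_Suc0_iff_eq)
  moreover have "card C \<le> card ?U + card (C - ?U)"
    using finC finU card_Un_le[of ?U "C - ?U"] card_mono[of "?U \<union> (C - ?U)" C] by fastforce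
  ultimately show ?thesis using card_Union_matching[OF G gMC] by simp
qed

subsection \<open>The bound\<close>

text \<open>The weights \<open>a\<close> and \<open>b\<close> stay abstract so that one induction on
  the number of vertices serves both parities. In \<open>component_bound\<close>, the numbers
  \<open>N\<close>, \<open>e\<close> and \<open>r\<close> stand for the vertices, edges and matching
  edges of one component. Given the degree bound, the last hypothesis says that no component is
  \<open>k\<close>-regular.\<close>

lemma matching_number_lower_bound:
  fixes a b :: real
  assumes ab: "0 \<le> a" "0 \<le> b" "(a + b) * real k \<le> 1"
    and component_bound: "\<And>N e r :: nat. \<lbrakk>1 \<le> N; 2 * e < k * N; 2 * e \<le> N * (N - 1); N \<le> 2 * r + 1\<rbrakk>
      \<Longrightarrow> a * (real N - 1) + b * real e \<le> real r"
    and "simple_graph V E" "\<And>v. v \<in> V \<Longrightarrow> graph_degree E v \<le> k"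
    and "\<And>C. C \<in> graph_components V E \<Longrightarrow> \<exists>u\<in>C. graph_degree E u < k"
  shows "a * (real (card V) - real (card (graph_components V E))) + b * real (card E)
    \<le> real (matching_number E)"
  using assms(5-)
proof (induction "card V" arbitrary: V E rule: less_induct)
  case less
  note G = \<open>simple_graph V E\<close>
  note deg = less.prems(2)
  have fin: "finite V" "finite E" using simple_graph_finite[OF G] by auto
  show ?case
  proof (cases "\<exists>v\<in>V. \<forall>M. maximum_matching E M \<longrightarrow> v \<in> \<Union>M")
    case True
    then obtain v where v: "v \<in> V" and cov: "\<And>M. maximum_matching E M \<Longrightarrow> v \<in> \<Union>M" by blast
    let ?V = "V - {v}" and ?E = "induced_edges E (V - {v})"
    have subE: "?E \<subseteq> E" by (auto simp: induced_edges_def)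
    have IH: "a * (real (card ?V) - real (card (graph_components ?V ?E))) + b * real (card ?E)
        \<le> real (matching_number ?E)"
    proof (rule less.hyps)
      show "card ?V < card V" using fin(1) v by (rule card_Diff1_less)
      show "simple_graph ?V ?E" by (rule simple_graph_induced[OF G]) auto
      show "graph_degree ?E w \<le> k" if "w \<in> ?V" for w
        using that deg[of w] graph_degree_mono[OF fin(2) subE, of w] by auto
      show "\<exists>u\<in>C. graph_degree ?E u < k" if C: "C \<in> graph_components ?V ?E" for C
      proof (cases "\<exists>w\<in>C. {v, w} \<in> E")
        case True
        then obtain w where w: "w \<in> C" "{v, w} \<in> E" by blast
        have "{v, w} \<notin> ?E" by (auto simp: induced_edges_def)
        then have "graph_degree ?E w < graph_degree E w"
          using graph_degree_strict_mono[OF fin(2) subE w(2)] by blast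
        also have "\<dots> \<le> k" using deg w(1) component_subset[OF C] by blast
        finally show ?thesis using w(1) by blast
      next
        case False
        then have "C \<in> graph_components V E" using component_delete_vertex[OF G C] by blast
        then obtain u where "u \<in> C" "graph_degree E u < k" using less.prems(3) by blast
        then show ?thesis using graph_degree_mono[OF fin(2) subE, of u] le_less_trans by blast
      qed
    qed
    let ?d = "graph_degree E v"
    have n: "real (card V) = real (card ?V) + 1" using card_Suc_Diff1[OF fin(1) v] by linarith
    have m: "real (card E) = real (card ?E) + real ?d"
      using card_edges_delete_vertex[OF G, of v] by simp
    \<comment> \<open>One vertex is lost, and the number of components grows by at most
      \<open>?d - 1\<close>.\<close>
    have "real (card V) - real (card (graph_components V E))
        \<le> real (card ?V) - real (card (graph_components ?V ?E)) + real ?d"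
      using n card_components_delete_vertex[OF G v] by linarith
    then have "a * (real (card V) - real (card (graph_components V E)))
        \<le> a * (real (card ?V) - real (card (graph_components ?V ?E)) + real ?d)"
      using ab(1) by (rule mult_left_mono)
    moreover have "(a + b) * real ?d \<le> 1"
    proof -
      have "(a + b) * real ?d \<le> (a + b) * real k"
        using ab deg[OF v] by (intro mult_left_mono) auto
      then show ?thesis using ab(3) by linarith
    qed
    moreover have "real (matching_number ?E) + 1 \<le> real (matching_number E)"
      using matching_number_delete_vertex[OF G cov] by linarith
    ultimately show ?thesis using IH m by (simp add: algebra_simps)
  next
    case False
    then have all_missed: "\<And>v. v \<in> V \<Longrightarrow> \<exists>M. maximum_matching E M \<and> v \<notin> \<Union>M" by blast
    obtain M where M: "maximum_matching E M" using maximum_matching_exists[OF fin(2)] .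
    then have ME: "M \<subseteq> E" by (auto simp: maximum_matching_def graph_matching_def)
    let ?K = "graph_components V E"
    \<comment> \<open>Each component contributes its order to \<open>n\<close> and one to
      \<open>c\<close>, so the bound splits into one term per component.\<close>
    have "a * (real (card V) - real (card ?K)) + b * real (card E)
        = (\<Sum>C\<in>?K. a * (real (card C) - 1) + b * real (card (induced_edges E C)))"
      using card_component_sum[OF fin(1), of E] card_induced_edges_sum[OF G order.refl]
      by (simp add: sum.distrib sum_distrib_left[symmetric] sum_subtractf)
    also have "\<dots> \<le> (\<Sum>C\<in>?K. real (card (induced_edges M C)))"
    proof (rule sum_mono, rule component_bound)
      fix C assume C: "C \<in> ?K"
      have sub: "C \<subseteq> V" using component_subset[OF C] .
      have GC: "simple_graph C (induced_edges E C)" by (rule simple_graph_induced[OF G sub])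
      show "1 \<le> card C"
        using component_nonempty[OF C] sub fin(1) finite_subset by (metis One_nat_def Suc_leI card_gt_0_iff)
      obtain u where u: "u \<in> C" "graph_degree E u < k" using less.prems(3)[OF C] by blast
      show "2 * card (induced_edges E C) < k * card C"
        using u sub deg by (intro card_edges_less[OF GC _ u(1)]) (auto simp: graph_degree_component[OF G C])
      show "2 * card (induced_edges E C) \<le> card C * (card C - 1)" by (rule card_edges_le[OF GC])
      show "card C \<le> 2 * card (induced_edges M C) + 1"
        using card_component_le_matching[OF G all_missed C M] .
    qed
    also have "\<dots> = real (card M)" using card_induced_edges_sum[OF G ME] by simp
    also have "\<dots> = real (matching_number E)" using M by (simp add: maximum_matching_def)
    finally show ?thesis .
  qed
qed

section \<open>Arithmetic for a single component, by the parities of \<open>N\<close> and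
  \<open>k\<close>\<close>

text \<open>
  The last assumption covers components with an odd number \<open>N > k\<close> of vertices. There the parity
  of \<open>k\<close> matters: \<open>k * N - 1\<close> cannot be twice the number of edges if \<open>k\<close> is even, and
  \<open>N = k + 1\<close> is excluded if \<open>k\<close> is odd.
\<close>

lemma component_bound:
  fixes a b :: real and N e r :: nat
  assumes ab: "0 \<le> a" "0 \<le> b" "(a + b) * real k = 1" and k: "2 \<le> k"
    and N: "1 \<le> N" "2 * e < k * N" "2 * e \<le> N * (N - 1)" "N \<le> 2 * r + 1"
    and large: "\<lbrakk>odd N; k < N\<rbrakk> \<Longrightarrow> 2 * (a * (real N - 1) + b * real e) \<le> real N - 1"
  shows "a * (real N - 1) + b * real e \<le> real r"
proof (cases "even N")
  case True
  \<comment> \<open>For even \<open>N\<close> the bound \<open>2 * r + 1\<close> improves to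
    \<open>2 * r\<close>, so the goal may be weakened from \<open>N - 1\<close> to \<open>N\<close>
    on the right.\<close>
  then have "real N \<le> 2 * real r" using N(4) by (elim evenE) auto
  have "2 * (a * (real N - 1) + b * real e) \<le> real N"
  proof -
    have "real (2 * e) \<le> real (k * N)" using N(2) by (intro of_nat_mono) simp
    then have "2 * real e \<le> real k * real N" by simp
    then have "b * (2 * real e) \<le> b * (real k * real N)" using ab(2) by (rule mult_left_mono)
    \<comment> \<open>Since \<open>k\<close> is at least 2, the vertex term also fits under weight
      \<open>k * N\<close>, and \<open>(a + b) * k = 1\<close> finishes.\<close>
    moreover have "a * (2 * real N) \<le> a * (real k * real N)"
      using ab(1) k by (intro mult_left_mono mult_right_mono) auto
    moreover have "a * (real k * real N) + b * (real k * real N) = real N"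
      using ab(3) by (metis distrib_right mult.assoc mult_1)
    ultimately show ?thesis using ab(1) by (simp add: algebra_simps)
  qed
  also note \<open>real N \<le> 2 * real r\<close>
  finally show ?thesis by simp
next
  case odd: False
  have "2 * (a * (real N - 1) + b * real e) \<le> real N - 1"
  proof (cases "k < N")
    case True
    then show ?thesis using large odd by blast
  next
    case False
    \<comment> \<open>For \<open>N \<le> k\<close> the trivial edge bound gives
      \<open>2 * e \<le> k * (N - 1)\<close>, and the even case repeats with \<open>N - 1\<close> in
      place of \<open>N\<close>.\<close>
    have "real (2 * e) \<le> real (N * (N - 1))" using N(3) by (rule of_nat_mono)
    then have "2 * real e \<le> real N * (real N - 1)" using N(1) by (simp add: of_nat_diff)
    also have "\<dots> \<le> real k * (real N - 1)" using False N(1) by (intro mult_right_mono) auto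
    finally have "b * (2 * real e) \<le> b * (real k * (real N - 1))" using ab(2) by (rule mult_left_mono)
    moreover have "a * (2 * (real N - 1)) \<le> a * (real k * (real N - 1))"
      using ab(1) k N(1) by (intro mult_left_mono mult_right_mono) auto
    moreover have "a * (real k * (real N - 1)) + b * (real k * (real N - 1)) = real N - 1"
      using ab(3) by (metis distrib_right mult.assoc mult_1)
    ultimately show ?thesis by (simp add: algebra_simps)
  qed
  also have "real N - 1 \<le> 2 * real r" using N(4) by linarith
  finally show ?thesis by simp
qed

text \<open>The critical component has \<open>N = k + 1\<close> and
  \<open>2 * e = k * N - 2\<close>: there the inequality for large odd \<open>N\<close> is an
  equality. Together with \<open>(a + b) * k = 1\<close> this determines the two
  coefficients.\<close>

lemma component_bound_even:
  fixes N e r k :: nat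
  assumes k: "3 \<le> k" "even k"
    and N: "1 \<le> N" "2 * e < k * N" "2 * e \<le> N * (N - 1)" "N \<le> 2 * r + 1"
  shows "1 / (real k * (real k + 1)) * (real N - 1) + 1 / (real k + 1) * real e \<le> real r"
proof (rule component_bound[OF _ _ _ _ N])
  have pos: "real k > 0" "real k + 1 > 0" using k by auto
  show "(1 / (real k * (real k + 1)) + 1 / (real k + 1)) * real k = 1"
    using pos by (simp add: divide_simps)
  assume "odd N" "k < N"
  have "2 * e \<noteq> k * N - 1" using k N(1) by (metis One_nat_def Suc_leI even_mult_iff even_Suc
      dvd_triv_left mult_is_0 neq0_conv not_numeral_le_zero Suc_diff_1 not_one_le_zero)
  then have "real (2 * e + 2) \<le> real (k * N)" using N(2) by (intro of_nat_mono) linarith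
  then have e: "2 * real e + 2 \<le> real k * real N" by simp
  \<comment> \<open>This product is exactly the slack left in the next inequality once
    \<open>e\<close> is replaced by its upper bound.\<close>
  have "(real k - 2) * (real N - 1 - real k) \<ge> 0" using k \<open>k < N\<close> by simp
  then have "2 * ((real N - 1) + real k * real e) \<le> (real N - 1) * (real k * (real k + 1))"
    using mult_left_mono[OF e, of "real k"] by (simp add: algebra_simps)
  then show "2 * (1 / (real k * (real k + 1)) * (real N - 1) + 1 / (real k + 1) * real e) \<le> real N - 1"
    using pos by (simp add: divide_simps) (simp add: algebra_simps)
qed (use k in auto)

text \<open>Here the critical values are \<open>N = k + 2\<close> and
  \<open>2 * e = k * N - 1\<close>; they play the same part in fixing the coefficients.\<close>

lemma component_bound_odd:
  fixes N e r k :: nat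
  assumes k: "3 \<le> k" "odd k"
    and N: "1 \<le> N" "2 * e < k * N" "2 * e \<le> N * (N - 1)" "N \<le> 2 * r + 1"
  shows "(real k - 1) / (real k * ((real k)^2 - 3)) * (real N - 1)
    + ((real k)^2 - real k - 2) / (real k * ((real k)^2 - 3)) * real e \<le> real r"
proof (rule component_bound[OF _ _ _ _ N])
  have k3: "real k \<ge> 3" using k by simp
  have "(real k)^2 \<ge> 9" using power_mono[OF k3, of 2] by simp
  then have pos: "real k > 0" "(real k)^2 - 3 > 0" using k3 by linarith+
  have fac: "(real k)^2 - real k - 2 = (real k + 1) * (real k - 2)"
    by (simp add: algebra_simps power2_eq_square)
  have nonneg: "0 \<le> (real k)^2 - real k - 2" unfolding fac using k3 by simp
  let ?D = "real k * ((real k)^2 - 3)"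
  have D: "?D > 0" using pos by simp
  show "0 \<le> (real k - 1) / ?D" "0 \<le> ((real k)^2 - real k - 2) / ?D"
    using D k3 nonneg by auto
  \<comment> \<open>The two numerators add up to \<open>k^2 - 3\<close>, which cancels against
    \<open>?D\<close> and leaves \<open>1 / k\<close>.\<close>
  have "(real k - 1) / ?D + ((real k)^2 - real k - 2) / ?D = ((real k)^2 - 3) / ?D"
    by (simp add: add_divide_distrib[symmetric])
  then show "((real k - 1) / ?D + ((real k)^2 - real k - 2) / ?D) * real k = 1"
    using pos by simp
  assume "odd N" "k < N"
  \<comment> \<open>\<open>k + 1\<close> is even, while \<open>N\<close> is odd.\<close>
  then have "k + 2 \<le> N" using k(2) by (metis Suc_leI add_2_eq_Suc' even_Suc le_neq_implies_less)
  then have N2: "real N - 1 \<ge> real k + 1" by linarith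
  have "real (2 * e + 1) \<le> real (k * N)" using N(2) by (intro of_nat_mono) simp
  then have e: "2 * real e + 1 \<le> real k * real N" by simp
  have "((real k)^2 - real k - 2) * (2 * real e + 1) \<le> ((real k)^2 - real k - 2) * (real k * real N)"
    using e nonneg by (rule mult_left_mono)
  \<comment> \<open>Again the exact slack after inserting the bound on \<open>e\<close>; it vanishes
    at \<open>N = k + 2\<close>.\<close>
  moreover have "(real k - 1) * (real k - 2) * (real N - 1 - (real k + 1)) \<ge> 0"
    using k3 N2 by simp
  ultimately have "2 * ((real k - 1) * (real N - 1) + ((real k)^2 - real k - 2) * real e) \<le> (real N - 1) * ?D"
    by (simp add: algebra_simps power2_eq_square)
  then have "2 * ((real k - 1) * (real N - 1) + ((real k)^2 - real k - 2) * real e) / ?D \<le> real N - 1"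
    using D by (simp only: pos_divide_le_eq)
  then show "2 * ((real k - 1) / ?D * (real N - 1) + ((real k)^2 - real k - 2) / ?D * real e) \<le> real N - 1"
    by (simp add: add_divide_distrib distrib_left)
qed (use k in auto)

theorem theorem4:
  fixes V :: "'a set" and E :: "'a set set" and k n m c :: nat
  assumes "k \<ge> 3"
    and "simple_graph V E"
    and "c = card (graph_components V E)"
    and "n = card V"
    and "m = card E"
    and "max_degree V E \<le> k"
    and "\<And>C. C \<in> graph_components V E \<Longrightarrow> \<not> regular_graph k C (induced_edges E C)"
  shows "(even k \<longrightarrow>
            real (matching_number E) \<ge>
              (1 / (real k * (real k + 1))) * (real n - real c) + (1 / (real k + 1)) * real m)
       \<and> (odd k \<longrightarrow>
            real (matching_number E) \<ge>
              ((real k - 1) / (real k * ((real k)^2 - 3))) * (real n - real c)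
              + (((real k)^2 - real k - 2) / (real k * ((real k)^2 - 3))) * real m)"
proof -
  have deg: "graph_degree E v \<le> k" if "v \<in> V" for v
    using that assms(6) simple_graph_finite(1)[OF assms(2)] by (auto simp: max_degree_def)
  \<comment> \<open>Degrees inside a component agree with those in the whole graph, so a component
    that is not \<open>k\<close>-regular has a vertex of degree other than \<open>k\<close>, hence
    smaller.\<close>
  have low: "\<exists>u\<in>C. graph_degree E u < k" if C: "C \<in> graph_components V E" for C
    using assms(7)[OF C] deg component_subset[OF C] graph_degree_component[OF assms(2) C]
    by (metis le_neq_implies_less regular_graph_def subsetD)
  show ?thesis
    unfolding assms(3-5)
  proof (intro conjI impI)
    assume "even k"
    have "(1 / (real k * (real k + 1)) + 1 / (real k + 1)) * real k \<le> 1"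
      using assms(1) by (simp add: divide_simps)
    then show "1 / (real k * (real k + 1)) * (real (card V) - real (card (graph_components V E)))
        + 1 / (real k + 1) * real (card E) \<le> real (matching_number E)"
      by (intro matching_number_lower_bound[OF _ _ _ component_bound_even[OF assms(1) \<open>even k\<close>]
            assms(2) deg low]) auto
  next
    assume "odd k"
    let ?D = "real k * ((real k)^2 - 3)"
    have k3: "real k \<ge> 3" using assms(1) by simp
    have "(real k)^2 \<ge> 3 * real k" using k3 by (simp add: power2_eq_square)
    then have pos: "(real k)^2 - 3 > 0" "(real k)^2 - real k - 2 \<ge> 0" using k3 by linarith+
    have "(real k - 1) / ?D + ((real k)^2 - real k - 2) / ?D = ((real k)^2 - 3) / ?D"
      by (simp add: add_divide_distrib[symmetric])
    then have "((real k - 1) / ?D + ((real k)^2 - real k - 2) / ?D) * real k \<le> 1"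
      using pos k3 by simp
    then show "(real k - 1) / ?D * (real (card V) - real (card (graph_components V E)))
        + ((real k)^2 - real k - 2) / ?D * real (card E) \<le> real (matching_number E)"
      using pos k3
      by (intro matching_number_lower_bound[OF _ _ _ component_bound_odd[OF assms(1) \<open>odd k\<close>]
            assms(2) deg low]) auto
  qed
qed

end
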